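(* Let $K=(V,\mathcal{C})$ be a neighbourly abstract cubical complex with $V$ a finite set, and let $G=(V,E)$ be the graph of $K$. Then the edge expansion of $G$ satisfies $\chi(G)\geq 1$.
   Context: An (abstract) cubical complex is a pair $K=(V,\mathcal{C})$ of a set $V$ and a set $\mathcal{C}$ of subsets of $V$ ("cubes") such that (1) $c_1,c_2\in\mathcal{C}\Rightarrow c_1\cap c_2\in\mathcal{C}$, and (2) for every $c\in\mathcal{C}$ there is $d\geq 0$ and a bijection $\phi_c:\{0,1\}^d\to c$ such that for a subset $s\subseteq\{0,1\}^d$, the image $\phi_c(s)$ is a member of $\mathcal{C}$ if and only if $s$ is (the vertex set of) a face of the cube $[0,1]^d$. The graph of $K$ is the graph $G=(V,E)$ with $\{v_1,v_2\}\in E$ if and only if $\{v_1,v_2\}\in\mathcal{C}$ (with $v_1\neq v_2$). The complex is neighbourly if for every pair of vertices $v,w\in V$ there is a cube $c\in\mathcal{C}$ with $v,w\in c$. The edge expansion of a graph $G=(V,E)$ is $\chi(G)=\min_{X\subset V,\ 0<|X|\leq \frac12|V|}\frac{|\delta(X)|}{|X|}$, where $\delta(X)$ is the set of edges with exactly one endpoint in $X$.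
   Formalization: The empty set counts as a face and a member of 𝒞 and is exempted from condition (2), since otherwise no complex could contain two distinct vertices in cubes; for |V| ≤ 1 the minimum over no sets X is taken to be ∞. *)

theory Defs
  imports Complex_Main "HOL-Library.FuncSet" "HOL-Library.Extended_Real"
begin

section \<open>Faces of the cube\<close>

definition unit_cube :: "nat \<Rightarrow> (nat \<Rightarrow> real) set" where
  "unit_cube d = {..<d} \<rightarrow>\<^sub>E {0..1}"

definition cube_vertices :: "nat \<Rightarrow> (nat \<Rightarrow> real) set" where
  "cube_vertices d = {..<d} \<rightarrow>\<^sub>E {0, 1}"

text \<open>Faces in the sense of polytope theory: the points where a valid linear inequality is tight.
  The empty set and the cube itself are faces.\<close>

definition cube_face :: "nat \<Rightarrow> (nat \<Rightarrow> real) set \<Rightarrow> bool" where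
  "cube_face d F \<longleftrightarrow>
     (\<exists>a b. (\<forall>x\<in>unit_cube d. (\<Sum>i<d. a i * x i) \<le> b) \<and>
            F = {x \<in> unit_cube d. (\<Sum>i<d. a i * x i) = b})"

definition cube_face_vertices :: "nat \<Rightarrow> (nat \<Rightarrow> real) set \<Rightarrow> bool" where
  "cube_face_vertices d s \<longleftrightarrow> (\<exists>F. cube_face d F \<and> s = F \<inter> cube_vertices d)"

lemma cube_vertices_subset: "cube_vertices d \<subseteq> unit_cube d"
  unfolding cube_vertices_def unit_cube_def by (rule PiE_mono) auto

text \<open>The nonempty faces arise by fixing some of the coordinates to 0 or 1.\<close>

lemma cube_face_vertices_iff:
  "cube_face_vertices d s \<longleftrightarrow>
     s = {} \<or> (\<exists>I v. I \<subseteq> {..<d} \<and> v \<in> cube_vertices d \<and>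
                     s = {x \<in> cube_vertices d. \<forall>i\<in>I. x i = v i})"
    (is "_ \<longleftrightarrow> _ \<or> ?R")
proof
  assume "cube_face_vertices d s"
  then obtain a b where le: "\<And>x. x \<in> unit_cube d \<Longrightarrow> (\<Sum>i<d. a i * x i) \<le> b"
    and s: "s = {x \<in> unit_cube d. (\<Sum>i<d. a i * x i) = b} \<inter> cube_vertices d"
    unfolding cube_face_vertices_def cube_face_def by blast
  show "s = {} \<or> ?R"
  proof (cases "s = {}")
    case False
    then obtain y where y: "y \<in> cube_vertices d" "(\<Sum>i<d. a i * y i) = b"
      using s by auto
    define v where "v = (\<lambda>i\<in>{..<d}. if a i > 0 then 1 else (0::real))"
    have v: "v \<in> cube_vertices d"
      by (auto simp: v_def cube_vertices_def)
    have termwise: "a i * x i \<le> a i * v i" if "x \<in> cube_vertices d" "i < d" for x i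
    proof -
      have "x i = 0 \<or> x i = 1" using that by (auto simp: cube_vertices_def PiE_def Pi_def)
      then show ?thesis using that(2) by (auto simp: v_def)
    qed
    have "b \<le> (\<Sum>i<d. a i * v i)"
      unfolding y(2)[symmetric] using termwise[OF y(1)] by (intro sum_mono) auto
    then have vb: "(\<Sum>i<d. a i * v i) = b"
      using le v cube_vertices_subset by (meson antisym subsetD)
    have eq: "(\<Sum>i<d. a i * x i) = b \<longleftrightarrow> (\<forall>i\<in>{i. i < d \<and> a i \<noteq> 0}. x i = v i)"
      if "x \<in> cube_vertices d" for x
    proof -
      have "(\<Sum>i<d. a i * x i) = b \<longleftrightarrow> (\<Sum>i<d. a i * v i - a i * x i) = 0"
        using vb by (auto simp: sum_subtractf)
      also have "\<dots> \<longleftrightarrow> (\<forall>i\<in>{..<d}. a i * v i - a i * x i = 0)"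
        using termwise[OF that] by (intro sum_nonneg_eq_0_iff) auto
      finally show ?thesis by auto
    qed
    have "s = {x \<in> cube_vertices d. \<forall>i\<in>{i. i < d \<and> a i \<noteq> 0}. x i = v i}"
      using eq cube_vertices_subset s by blast
    then have ?R using v by (intro exI[of _ "{i. i < d \<and> a i \<noteq> 0}"] exI[of _ v]) auto
    then show ?thesis ..
  qed simp
next
  assume "s = {} \<or> ?R"
  then show "cube_face_vertices d s"
  proof
    assume "s = {}"
    then show ?thesis unfolding cube_face_vertices_def cube_face_def
      by (intro exI[of _ "{}"] conjI exI[of _ "\<lambda>_. 0"] exI[of _ 1]) auto
  next
    assume ?R
    then obtain I v where I: "I \<subseteq> {..<d}" and v: "v \<in> cube_vertices d"
      and s: "s = {x \<in> cube_vertices d. \<forall>i\<in>I. x i = v i}" by blast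
    define a where "a = (\<lambda>i. if i \<in> I then 2 * v i - 1 else 0)"
    define b where "b = (\<Sum>i<d. a i * v i)"
    have v01: "v i = 0 \<or> v i = 1" if "i < d" for i
      using v that by (auto simp: cube_vertices_def PiE_def Pi_def)
    have termwise: "a i * x i \<le> a i * v i" if "x \<in> unit_cube d" "i < d" for x i
    proof -
      have "0 \<le> x i" "x i \<le> 1" using that by (auto simp: unit_cube_def PiE_def Pi_def)
      then show ?thesis using v01[OF that(2)] by (auto simp: a_def)
    qed
    have le: "(\<Sum>i<d. a i * x i) \<le> b" if "x \<in> unit_cube d" for x
      unfolding b_def using termwise[OF that] by (intro sum_mono) auto
    have eq: "(\<Sum>i<d. a i * x i) = b \<longleftrightarrow> (\<forall>i\<in>I. x i = v i)" if "x \<in> unit_cube d" for x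
    proof -
      have "(\<Sum>i<d. a i * x i) = b \<longleftrightarrow> (\<Sum>i<d. a i * v i - a i * x i) = 0"
        by (auto simp: sum_subtractf b_def)
      also have "\<dots> \<longleftrightarrow> (\<forall>i\<in>{..<d}. a i * v i - a i * x i = 0)"
        using termwise[OF that] by (intro sum_nonneg_eq_0_iff) auto
      also have "\<dots> \<longleftrightarrow> (\<forall>i\<in>I. x i = v i)"
      proof -
        have "a i * v i - a i * x i = 0 \<longleftrightarrow> (i \<in> I \<longrightarrow> x i = v i)" if "i < d" for i
          using v01[OF that] by (auto simp: a_def)
        then show ?thesis using I by auto
      qed
      finally show ?thesis .
    qed
    have "s = {x \<in> unit_cube d. (\<Sum>i<d. a i * x i) = b} \<inter> cube_vertices d"
      unfolding s using eq cube_vertices_subset by blast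
    then show ?thesis unfolding cube_face_vertices_def cube_face_def using le by blast
  qed
qed


section \<open>Abstract cubical complexes\<close>

text \<open>The empty set is a face of every cube and serves as the intersection of disjoint cubes, so
  it belongs to every complex that has a cube at all. As it is not in bijection with any
  \<open>{0,1}^d\<close>, it has to be exempted from the second condition: without the
  exemption no complex could have two distinct vertices in cubes.\<close>

definition cubical_complex :: "'a set \<Rightarrow> 'a set set \<Rightarrow> bool" where
  "cubical_complex V C \<longleftrightarrow>
     (\<forall>c\<in>C. c \<subseteq> V) \<and>
     (\<forall>c1\<in>C. \<forall>c2\<in>C. c1 \<inter> c2 \<in> C) \<and>
     (\<forall>c\<in>C. c \<noteq> {} \<longrightarrow>
        (\<exists>d \<phi>. bij_betw \<phi> (cube_vertices d) c \<and>
               (\<forall>s. s \<subseteq> cube_vertices d \<longrightarrow> (\<phi> ` s \<in> C \<longleftrightarrow> cube_face_vertices d s))))"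

definition neighbourly :: "'a set \<Rightarrow> 'a set set \<Rightarrow> bool" where
  "neighbourly V C \<longleftrightarrow> (\<forall>v\<in>V. \<forall>w\<in>V. \<exists>c\<in>C. v \<in> c \<and> w \<in> c)"

definition complex_edges :: "'a set \<Rightarrow> 'a set set \<Rightarrow> 'a set set" where
  "complex_edges V C = {{v, w} | v w. v \<in> V \<and> w \<in> V \<and> v \<noteq> w \<and> {v, w} \<in> C}"


section \<open>Edge expansion\<close>

definition edge_boundary :: "'a set set \<Rightarrow> 'a set \<Rightarrow> 'a set set" where
  "edge_boundary E X = {e \<in> E. card (e \<inter> X) = 1}"

text \<open>Extended reals make the minimum over no sets \<open>X\<close> at all, which is the case
  \<open>card V \<le> 1\<close>, equal to \<open>\<infinity>\<close>. Otherwise the infimum is an ordinary minimum of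
  finitely many reals.\<close>

definition edge_expansion :: "'a set \<Rightarrow> 'a set set \<Rightarrow> ereal" where
  "edge_expansion V E =
     (INF X \<in> {X. X \<subseteq> V \<and> 0 < card X \<and> real (card X) \<le> real (card V) / 2}.
        ereal (real (card (edge_boundary E X)) / real (card X)))"

lemma edge_expansion_eq_Min:
  assumes "finite V" and "card V \<ge> 2"
  shows "edge_expansion V E =
    ereal (Min ((\<lambda>X. real (card (edge_boundary E X)) / real (card X)) `
      {X. X \<subseteq> V \<and> 0 < card X \<and> real (card X) \<le> real (card V) / 2}))"
proof -
  let ?S = "{X. X \<subseteq> V \<and> 0 < card X \<and> real (card X) \<le> real (card V) / 2}"
  let ?f = "\<lambda>X. real (card (edge_boundary E X)) / real (card X)"
  have fin: "finite ?S"
    by (rule finite_subset[of _ "Pow V"]) (use assms(1) in auto)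
  obtain v where "v \<in> V" using assms by fastforce
  then have "{v} \<in> ?S" using assms by auto
  then have ne: "?S \<noteq> {}" by blast
  have "Min (?f ` ?S) \<in> ?f ` ?S"
    using fin ne by (intro Min_in) blast+
  then obtain X where X: "X \<in> ?S" "Min (?f ` ?S) = ?f X"
    by (rule imageE)
  show ?thesis unfolding edge_expansion_def
  proof (rule antisym)
    show "(INF X\<in>?S. ereal (?f X)) \<le> ereal (Min (?f ` ?S))"
      using X by (intro INF_lower2[of X]) simp_all
    show "ereal (Min (?f ` ?S)) \<le> (INF X\<in>?S. ereal (?f X))"
    proof (rule INF_greatest)
      fix Y assume "Y \<in> ?S"
      then have "Min (?f ` ?S) \<le> ?f Y" using fin by (intro Min_le) auto
      then show "ereal (Min (?f ` ?S)) \<le> ereal (?f Y)" by simp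
    qed
  qed
qed

end

theory Submission
  imports Defs
begin

text \<open>Neighbourliness gives any two vertices \<open>x, y\<close> a smallest common cube, in which they are
  antipodal. Walking from \<open>x\<close> to its antipode by flipping the coordinates in order, an edge
  and the direction in which it is traversed determine \<open>x\<close>; so in each cube, at least as many
  edges as antipodal pairs are separated by \<open>X\<close>. Summing over all cubes bounds \<open>|X| |V - X|\<close>
  by the number of incidences between edges of \<open>\<delta>(X)\<close> and cubes. An edge \<open>uv\<close> lies in at most
  \<open>|V|/2\<close> cubes, since the antipodes of \<open>u\<close> and of \<open>v\<close> in the cubes through \<open>uv\<close> are all
  distinct. Hence \<open>|X| |V - X| \<le> |\<delta>(X)| |V|/2\<close>.\<close>

section \<open>Paths between antipodal vertices of the cube\<close>

text \<open>For \<open>k\<close> from 0 to \<open>d\<close> these are the vertices of the walk from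
  \<open>p\<close> to its antipode. The restriction to \<open>{..<d}\<close> keeps them extensional,
  as membership in \<open>cube_vertices d\<close> requires.\<close>

definition flip_below :: "nat \<Rightarrow> nat \<Rightarrow> (nat \<Rightarrow> real) \<Rightarrow> nat \<Rightarrow> real" where
  "flip_below d k p = (\<lambda>i\<in>{..<d}. if i < k then 1 - p i else p i)"

abbreviation antipode :: "nat \<Rightarrow> (nat \<Rightarrow> real) \<Rightarrow> nat \<Rightarrow> real" where
  "antipode d \<equiv> flip_below d d"

lemma cube_vertices_01: "p \<in> cube_vertices d \<Longrightarrow> i < d \<Longrightarrow> p i = 0 \<or> p i = 1"
  by (auto simp: cube_vertices_def PiE_def Pi_def)

lemma cube_vertices_eqI:
  assumes "p \<in> cube_vertices d" "q \<in> cube_vertices d" "\<And>i. i < d \<Longrightarrow> p i = q i"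
  shows "p = q"
  using assms unfolding cube_vertices_def by (intro PiE_ext) auto

lemma finite_cube_vertices: "finite (cube_vertices d)"
  unfolding cube_vertices_def by (intro finite_PiE) auto

lemma flip_below_in_cube_vertices:
  assumes "p \<in> cube_vertices d"
  shows "flip_below d k p \<in> cube_vertices d"
proof -
  have "flip_below d k p i \<in> {0, 1}" if "i < d" for i
    using cube_vertices_01[OF assms that] that by (auto simp: flip_below_def)
  then show ?thesis unfolding cube_vertices_def flip_below_def by auto
qed

lemma flip_below_0: "p \<in> cube_vertices d \<Longrightarrow> flip_below d 0 p = p"
  by (rule cube_vertices_eqI[OF flip_below_in_cube_vertices]) (auto simp: flip_below_def)

lemma flip_below_flip_below: "p \<in> cube_vertices d \<Longrightarrow> flip_below d k (flip_below d k p) = p"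
  by (rule cube_vertices_eqI[OF flip_below_in_cube_vertices[OF flip_below_in_cube_vertices]])
    (auto simp: flip_below_def)

text \<open>This makes the walk decodable: the coordinate in which the ends of one of its edges
  differ is the number of flips made before that edge.\<close>

lemma flip_below_Suc_neq_iff:
  assumes "p \<in> cube_vertices d" "k < d" "i < d"
  shows "flip_below d (Suc k) p i \<noteq> flip_below d k p i \<longleftrightarrow> i = k"
  using cube_vertices_01[OF assms(1,3)] assms(3) by (auto simp: flip_below_def less_Suc_eq)

lemma eq_antipode_iff:
  assumes "p \<in> cube_vertices d" "q \<in> cube_vertices d"
  shows "q = antipode d p \<longleftrightarrow> (\<forall>i<d. q i \<noteq> p i)"
proof
  assume "q = antipode d p"
  then show "\<forall>i<d. q i \<noteq> p i"
    using cube_vertices_01[OF assms(1)] by (fastforce simp: flip_below_def)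
next
  assume neq: "\<forall>i<d. q i \<noteq> p i"
  show "q = antipode d p"
  proof (rule cube_vertices_eqI)
    fix i assume "i < d"
    then show "q i = antipode d p i"
      using neq cube_vertices_01[OF assms(1), of i] cube_vertices_01[OF assms(2), of i]
      by (auto simp: flip_below_def)
  qed (use assms flip_below_in_cube_vertices in auto)
qed

lemma cube_face_vertices_flip_edge:
  assumes p: "p \<in> cube_vertices d" and k: "k < d"
  shows "cube_face_vertices d {flip_below d k p, flip_below d (Suc k) p}"
proof -
  let ?q = "flip_below d k p" and ?r = "flip_below d (Suc k) p"
  have q: "?q \<in> cube_vertices d" and r: "?r \<in> cube_vertices d"
    using p flip_below_in_cube_vertices by auto
  have agree: "?r i = ?q i" if "i < d" "i \<noteq> k" for i
    using flip_below_Suc_neq_iff[OF p k that(1)] that(2) by blast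
  have rk: "?r k \<noteq> ?q k" using flip_below_Suc_neq_iff[OF p k k] by blast
  \<comment> \<open>Only coordinate \<open>k\<close> is free, and its two possible values are those
    taken by \<open>?q\<close> and \<open>?r\<close>.\<close>
  have "x = ?q \<or> x = ?r"
    if x: "x \<in> cube_vertices d" and eq: "\<forall>i\<in>{..<d} - {k}. x i = ?q i" for x
  proof (cases "x k = ?q k")
    case True
    then have "x = ?q" using eq by (intro cube_vertices_eqI[OF x q]) auto
    then show ?thesis ..
  next
    case False
    then have "x k = ?r k"
      using rk cube_vertices_01[OF x k] cube_vertices_01[OF q k] cube_vertices_01[OF r k] by auto
    then have "x = ?r"
      using eq agree by (intro cube_vertices_eqI[OF x r]) (metis DiffI lessThan_iff singletonD)
    then show ?thesis ..
  qed
  then have "{?q, ?r} = {x \<in> cube_vertices d. \<forall>i\<in>{..<d} - {k}. x i = ?q i}"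
    using q r agree by auto
  then show ?thesis
    unfolding cube_face_vertices_iff using q
    by (intro disjI2 exI[of _ "{..<d} - {k}"] exI[of _ ?q]) auto
qed

text \<open>A walk from a vertex in \<open>S\<close> to an antipode outside \<open>S\<close> must
  leave \<open>S\<close>. Charging the vertex to such a leaving edge is injective: the end in
  \<open>S\<close> tells the direction of the walk, and the differing coordinate tells how many
  flips to undo.\<close>

lemma card_separated_antipodes_le:
  fixes S :: "(nat \<Rightarrow> real) set"
  assumes S: "S \<subseteq> cube_vertices d"
  shows "card {p \<in> S. antipode d p \<notin> S} \<le>
    card {{q, r} | q r. q \<in> S \<and> r \<in> cube_vertices d - S \<and> cube_face_vertices d {q, r}}"
    (is "card ?P \<le> card ?E")
proof -
  have "\<exists>k<d. flip_below d k p \<in> S \<and> flip_below d (Suc k) p \<notin> S" if "p \<in> ?P" for p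
  proof (rule ccontr)
    assume none: "\<not> ?thesis"
    have "k \<le> d \<Longrightarrow> flip_below d k p \<in> S" for k
    proof (induction k)
      case 0
      then show ?case using that S flip_below_0 by fastforce
    next
      case (Suc k)
      then show ?case using none by auto
    qed
    then show False using that by auto
  qed
  then obtain k where k: "\<And>p. p \<in> ?P \<Longrightarrow>
      k p < d \<and> flip_below d (k p) p \<in> S \<and> flip_below d (Suc (k p)) p \<notin> S"
    by metis
  let ?f = "\<lambda>p. {flip_below d (k p) p, flip_below d (Suc (k p)) p}"
  have cube: "p \<in> cube_vertices d" if "p \<in> ?P" for p using that S by auto
  have inj: "inj_on ?f ?P"
  proof (rule inj_onI)
    fix p p' assume p: "p \<in> ?P" and p': "p' \<in> ?P" and eq: "?f p = ?f p'"
    \<comment> \<open>On both walks the end in \<open>S\<close> comes first, so the edges agree as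
      directed edges.\<close>
    have e1: "flip_below d (k p) p = flip_below d (k p') p'"
      and e2: "flip_below d (Suc (k p)) p = flip_below d (Suc (k p')) p'"
      using eq k[OF p] k[OF p'] by (auto simp: doubleton_eq_iff)
    have kd: "k p < d" "k p' < d" using k p p' by auto
    have "k p = k p'"
      using flip_below_Suc_neq_iff[OF cube[OF p] kd(1) kd(1)]
        flip_below_Suc_neq_iff[OF cube[OF p'] kd(2) kd(1)] e1 e2 by auto
    then show "p = p'" using e1 flip_below_flip_below cube p p' by metis
  qed
  have "?f p \<in> ?E" if "p \<in> ?P" for p
    using k[OF that] cube[OF that] flip_below_in_cube_vertices cube_face_vertices_flip_edge by blast
  then have sub: "?f ` ?P \<subseteq> ?E" by blast
  have "?E \<subseteq> Pow (cube_vertices d)" using S by auto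
  then have "finite ?E" using finite_cube_vertices by (meson finite_Pow_iff finite_subset)
  then show ?thesis using card_inj_on_le[OF inj sub] by blast
qed


section \<open>Cubes spanned by two vertices\<close>

text \<open>Under the hypotheses of \<open>spanned_mem\<close> this is the smallest cube through
  \<open>x\<close> and \<open>y\<close>; neighbourliness keeps the intersected family nonempty, as
  an empty one would give \<open>UNIV\<close>.\<close>

definition spanned :: "'a set set \<Rightarrow> 'a \<Rightarrow> 'a \<Rightarrow> 'a set" where
  "spanned C x y = \<Inter>{c \<in> C. x \<in> c \<and> y \<in> c}"

lemma spanned_commute: "spanned C x y = spanned C y x"
  unfolding spanned_def by (rule arg_cong[of _ _ Inter]) auto

lemma spanned_subset: "c \<in> C \<Longrightarrow> x \<in> c \<Longrightarrow> y \<in> c \<Longrightarrow> spanned C x y \<subseteq> c"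
  unfolding spanned_def by blast

lemma in_spanned: "x \<in> spanned C x y" "y \<in> spanned C x y"
  unfolding spanned_def by auto

lemma Inter_mem_of_Int_closed:
  assumes "finite D" "D \<noteq> {}" "D \<subseteq> C" "\<forall>a\<in>C. \<forall>b\<in>C. a \<inter> b \<in> C"
  shows "\<Inter>D \<in> C"
  using assms by (induction D rule: finite_ne_induct) auto

lemma spanned_mem:
  assumes "cubical_complex V C" "neighbourly V C" "finite V" "x \<in> V" "y \<in> V"
  shows "spanned C x y \<in> C"
proof -
  have "C \<subseteq> Pow V" using assms(1) unfolding cubical_complex_def by auto
  then have "finite C" using assms(3) by (meson finite_Pow_iff finite_subset)
  moreover have "{c \<in> C. x \<in> c \<and> y \<in> c} \<noteq> {}"
    using assms(2,4,5) unfolding neighbourly_def by blast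
  moreover have "\<forall>c1\<in>C. \<forall>c2\<in>C. c1 \<inter> c2 \<in> C"
    using assms(1) unfolding cubical_complex_def by blast
  ultimately show ?thesis
    unfolding spanned_def by (intro Inter_mem_of_Int_closed) auto
qed

text \<open>Two vertices share a proper face of a cube exactly when they agree in some coordinate,
  and antipodes agree in none.\<close>

lemma spanned_eq_cube_iff_antipode:
  assumes Int: "\<forall>c1\<in>C. \<forall>c2\<in>C. c1 \<inter> c2 \<in> C"
    and c: "c \<in> C" and bij: "bij_betw \<phi> (cube_vertices d) c"
    and faces: "\<And>s. s \<subseteq> cube_vertices d \<Longrightarrow> \<phi> ` s \<in> C \<longleftrightarrow> cube_face_vertices d s"
    and p: "p \<in> cube_vertices d" and q: "q \<in> cube_vertices d"
  shows "spanned C (\<phi> p) (\<phi> q) = c \<longleftrightarrow> q = antipode d p"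
proof
  have im: "\<phi> ` cube_vertices d = c" and inj: "inj_on \<phi> (cube_vertices d)"
    using bij by (auto simp: bij_betw_def)
  have pc: "\<phi> p \<in> c" "\<phi> q \<in> c" using im p q by auto
  {
    assume span: "spanned C (\<phi> p) (\<phi> q) = c"
    show "q = antipode d p"
    proof (rule ccontr)
      assume "q \<noteq> antipode d p"
      then obtain i where i: "i < d" "q i = p i" using eq_antipode_iff[OF p q] by auto
      \<comment> \<open>The facet on which coordinate \<open>i\<close> has the common value is a
        cube through both vertices, so it contains their span \<open>c\<close>; yet it misses the
        antipode of \<open>p\<close>.\<close>
      define s where "s = {x \<in> cube_vertices d. \<forall>j\<in>{i}. x j = p j}"
      have s: "s \<subseteq> cube_vertices d" unfolding s_def by auto
      have "cube_face_vertices d s" unfolding cube_face_vertices_iff s_def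
        using i p by (intro disjI2 exI[of _ "{i}"] exI[of _ p]) auto
      then have "\<phi> ` s \<in> C" using faces s by blast
      moreover have "\<phi> p \<in> \<phi> ` s" "\<phi> q \<in> \<phi> ` s" using p q i unfolding s_def by auto
      ultimately have sub: "c \<subseteq> \<phi> ` s" using span spanned_subset by metis
      let ?r = "antipode d p"
      have r: "?r \<in> cube_vertices d" using p flip_below_in_cube_vertices by auto
      then have "?r \<in> s" using sub im inj s by (metis imageI inj_on_image_mem_iff subsetD)
      then show False using eq_antipode_iff[OF p r] i unfolding s_def by auto
    qed
  next
    assume anti: "q = antipode d p"
    have "c \<subseteq> c'" if c': "c' \<in> C" "\<phi> p \<in> c'" "\<phi> q \<in> c'" for c'
    proof -
      \<comment> \<open>Closure under intersection makes the trace of \<open>c'\<close> on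
        \<open>c\<close> a face. A face through two antipodes fixes no coordinate, so it is all of
        \<open>c\<close>.\<close>
      define s where "s = {x \<in> cube_vertices d. \<phi> x \<in> c'}"
      have "\<phi> ` s = c \<inter> c'" using im unfolding s_def by auto
      then have "\<phi> ` s \<in> C" using Int c c' by auto
      then have "cube_face_vertices d s" using faces[of s] unfolding s_def by auto
      moreover have ps: "p \<in> s" "q \<in> s" using p q c' unfolding s_def by auto
      ultimately obtain I v where I: "I \<subseteq> {..<d}"
        and s: "s = {x \<in> cube_vertices d. \<forall>i\<in>I. x i = v i}"
        unfolding cube_face_vertices_iff by auto
      have "q i = p i" if "i \<in> I" for i using ps that unfolding s by auto
      then have "I = {}" using anti eq_antipode_iff[OF p q] I by blast
      then have "s = cube_vertices d" using s by auto
      then show ?thesis using \<open>\<phi> ` s = c \<inter> c'\<close> im by auto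
    qed
    then show "spanned C (\<phi> p) (\<phi> q) = c" using c pc unfolding spanned_def by auto
  }
qed

lemma cubical_complexE:
  assumes "cubical_complex V C" "c \<in> C" "c \<noteq> {}"
  obtains d \<phi> where "bij_betw \<phi> (cube_vertices d) c"
    "\<And>s. s \<subseteq> cube_vertices d \<Longrightarrow> \<phi> ` s \<in> C \<longleftrightarrow> cube_face_vertices d s"
    "\<And>p q. p \<in> cube_vertices d \<Longrightarrow> q \<in> cube_vertices d \<Longrightarrow>
       spanned C (\<phi> p) (\<phi> q) = c \<longleftrightarrow> q = antipode d p"
proof -
  have Int: "\<forall>c1\<in>C. \<forall>c2\<in>C. c1 \<inter> c2 \<in> C"
    using assms(1) unfolding cubical_complex_def by blast
  obtain d \<phi> where b: "bij_betw \<phi> (cube_vertices d) c"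
    and f: "\<And>s. s \<subseteq> cube_vertices d \<Longrightarrow> \<phi> ` s \<in> C \<longleftrightarrow> cube_face_vertices d s"
    using assms unfolding cubical_complex_def by metis
  show ?thesis
    by (rule that[OF b f spanned_eq_cube_iff_antipode[OF Int assms(2) b f]])
qed

text \<open>The vertex \<open>w\<close> is the antipode of \<open>u\<close> in \<open>c\<close>.
  Described through spans alone, it does not depend on the choice of coordinates
  \<open>\<phi>\<close>.\<close>

lemma ex1_spanned_eq:
  assumes "cubical_complex V C" "c \<in> C" "u \<in> c"
  shows "\<exists>!w. w \<in> c \<and> spanned C u w = c"
proof -
  have "c \<noteq> {}" using assms by auto
  then obtain d \<phi> where bij: "bij_betw \<phi> (cube_vertices d) c"
    and sp: "\<And>p q. p \<in> cube_vertices d \<Longrightarrow> q \<in> cube_vertices d \<Longrightarrow>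
       spanned C (\<phi> p) (\<phi> q) = c \<longleftrightarrow> q = antipode d p"
    using cubical_complexE[OF assms(1,2)] by metis
  have im: "\<phi> ` cube_vertices d = c" using bij by (auto simp: bij_betw_def)
  obtain p where p: "p \<in> cube_vertices d" "u = \<phi> p" using assms(3) im by auto
  show ?thesis
  proof (rule ex1I[of _ "\<phi> (antipode d p)"])
    show "\<phi> (antipode d p) \<in> c \<and> spanned C u (\<phi> (antipode d p)) = c"
      using p sp im flip_below_in_cube_vertices by blast
    fix w assume w: "w \<in> c \<and> spanned C u w = c"
    then obtain q where q: "q \<in> cube_vertices d" "w = \<phi> q" using im by auto
    then show "w = \<phi> (antipode d p)" using sp[OF p(1) q(1)] p(2) w by simp
  qed
qed


section \<open>Counting incidences of boundary edges and cubes\<close>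

lemma card_cubes_containing_edge_le:
  assumes "cubical_complex V C" "finite V" "u \<noteq> v"
  shows "2 * card {c \<in> C. u \<in> c \<and> v \<in> c} \<le> card V"
proof -
  let ?D = "{c \<in> C. u \<in> c \<and> v \<in> c}"
  have CV: "c \<subseteq> V" if "c \<in> C" for c using that assms(1) unfolding cubical_complex_def by auto
  \<comment> \<open>\<open>a x c\<close> is the antipode of \<open>x\<close> in
    \<open>c\<close>.\<close>
  define a where "a x c = (THE w. w \<in> c \<and> spanned C x w = c)" for x c
  have a: "a x c \<in> c \<and> spanned C x (a x c) = c" if "c \<in> C" "x \<in> c" for x c
    unfolding a_def by (rule theI'[OF ex1_spanned_eq[OF assms(1) that]])
  have inj: "inj_on (a x) ?D" if "x \<in> {u, v}" for x
  proof (rule inj_on_inverseI)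
    fix c assume "c \<in> ?D"
    then have "c \<in> C" "x \<in> c" using that by auto
    then show "spanned C x (a x c) = c" using a[of c x] by simp
  qed
  have disj: "a u ` ?D \<inter> a v ` ?D = {}"
  proof (rule ccontr)
    assume "\<not> ?thesis"
    then obtain c c' where c: "c \<in> ?D" "c' \<in> ?D" "a u c = a v c'" by blast
    let ?w = "a u c"
    have su: "spanned C u ?w = c" "?w \<in> c" using a[of c u] c(1) by auto
    have sv: "spanned C v ?w = c'" "?w \<in> c'" using a[of c' v] c(2,3) by auto
    \<comment> \<open>The common antipode \<open>?w\<close> lies with \<open>v\<close> in
      \<open>c\<close> and with \<open>u\<close> in \<open>c'\<close>, so each cube contains the
      span that equals the other. Then \<open>u\<close> and \<open>v\<close> are both the antipode
      of \<open>?w\<close> in one cube.\<close>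
    have "c' \<subseteq> c" using spanned_subset[of c C v ?w] su sv c(1) by auto
    moreover have "c \<subseteq> c'" using spanned_subset[of c' C u ?w] su sv c(2) by auto
    ultimately have "c' = c" by auto
    then have "spanned C ?w u = c" "spanned C ?w v = c" "u \<in> c" "v \<in> c"
      using su sv c spanned_commute[of C ?w] by auto
    then show False using ex1_spanned_eq[OF assms(1), of c ?w] c(1) su(2) assms(3) by blast
  qed
  have "a x c \<in> V" if "c \<in> C" "x \<in> c" for x c using a[OF that] CV[OF that(1)] by blast
  then have sub: "a u ` ?D \<union> a v ` ?D \<subseteq> V" by auto
  have "2 * card ?D = card (a u ` ?D) + card (a v ` ?D)"
    using card_image[OF inj[of u]] card_image[OF inj[of v]] by simp
  also have "\<dots> = card (a u ` ?D \<union> a v ` ?D)"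
    using sub assms(2) disj by (intro card_Un_disjoint[symmetric]) (auto intro: finite_subset)
  also have "\<dots> \<le> card V" using sub assms(2) by (rule card_mono[rotated])
  finally show ?thesis .
qed

text \<open>In coordinates, the pairs spanning \<open>c\<close> are antipodal, so the walk count
  applies to the preimage of \<open>X\<close>; the edges it finds are faces and hence map to edges
  of the complex inside \<open>c\<close>.\<close>

lemma card_pairs_spanning_cube_le:
  assumes "cubical_complex V C" "finite V" "c \<in> C"
  shows "card {z \<in> X \<times> (V - X). spanned C (fst z) (snd z) = c} \<le>
    card {e \<in> edge_boundary (complex_edges V C) X. e \<subseteq> c}" (is "card ?Z \<le> card ?B")
proof (cases "c = {}")
  case True
  \<comment> \<open>A span contains its two vertices, so no pair spans the empty cube.\<close>
  then have "?Z = {}" using in_spanned by fastforce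
  then show ?thesis by (metis card.empty le0)
next
  case False
  then obtain d \<phi> where bij: "bij_betw \<phi> (cube_vertices d) c"
    and faces: "\<And>s. s \<subseteq> cube_vertices d \<Longrightarrow> \<phi> ` s \<in> C \<longleftrightarrow> cube_face_vertices d s"
    and sp: "\<And>p q. p \<in> cube_vertices d \<Longrightarrow> q \<in> cube_vertices d \<Longrightarrow>
       spanned C (\<phi> p) (\<phi> q) = c \<longleftrightarrow> q = antipode d p"
    using cubical_complexE[OF assms(1,3)] by metis
  have im: "\<phi> ` cube_vertices d = c" and inj: "inj_on \<phi> (cube_vertices d)"
    using bij by (auto simp: bij_betw_def)
  have cV: "c \<subseteq> V" using assms unfolding cubical_complex_def by auto
  define S where "S = {p \<in> cube_vertices d. \<phi> p \<in> X}"
  have S: "S \<subseteq> cube_vertices d" unfolding S_def by auto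
  let ?P = "{p \<in> S. antipode d p \<notin> S}"
  let ?E = "{{q, r} | q r. q \<in> S \<and> r \<in> cube_vertices d - S \<and> cube_face_vertices d {q, r}}"
  \<comment> \<open>The end in \<open>X\<close> determines the pair, since the other end is its
    antipode.\<close>
  have "?Z \<subseteq> (\<lambda>p. (\<phi> p, \<phi> (antipode d p))) ` ?P"
  proof
    fix z assume z: "z \<in> ?Z"
    then obtain x y where xy: "z = (x, y)" "x \<in> X" "y \<in> V - X" "spanned C x y = c" by auto
    then have "x \<in> c" "y \<in> c" using in_spanned by fastforce+
    then obtain p q where pq: "p \<in> cube_vertices d" "x = \<phi> p" "q \<in> cube_vertices d" "y = \<phi> q"
      using im by auto
    then have "q = antipode d p" using sp xy by auto
    then show "z \<in> (\<lambda>p. (\<phi> p, \<phi> (antipode d p))) ` ?P" using pq xy unfolding S_def by auto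
  qed
  moreover have "finite ?P" using S finite_cube_vertices by (auto intro: finite_subset)
  ultimately have "card ?Z \<le> card ?P" by (rule surj_card_le[rotated])
  also have "\<dots> \<le> card ?E" by (rule card_separated_antipodes_le[OF S])
  also have "\<dots> \<le> card ?B"
  proof (rule card_inj_on_le[of "image \<phi>"])
    have "?E \<subseteq> Pow (cube_vertices d)" using S by auto
    then show "inj_on (image \<phi>) ?E" using inj_on_image_Pow[OF inj] inj_on_subset by blast
    show "image \<phi> ` ?E \<subseteq> ?B"
    proof
      fix e assume "e \<in> image \<phi> ` ?E"
      then obtain q r where qr: "q \<in> S" "r \<in> cube_vertices d" "r \<notin> S"
        "cube_face_vertices d {q, r}" and e: "e = \<phi> ` {q, r}" by blast
      have "e \<in> C" unfolding e using faces[of "{q, r}"] qr S by blast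
      moreover have X: "\<phi> q \<in> X" "\<phi> r \<notin> X" using qr unfolding S_def by auto
      moreover have ec: "\<phi> q \<in> c" "\<phi> r \<in> c" using qr S im by auto
      ultimately have "\<phi> q \<in> V \<and> \<phi> r \<in> V \<and> \<phi> q \<noteq> \<phi> r \<and> {\<phi> q, \<phi> r} \<in> C"
        using cV e by auto
      then have "e \<in> complex_edges V C" unfolding complex_edges_def e by auto
      moreover have "e \<inter> X = {\<phi> q}" using X e by auto
      ultimately show "e \<in> ?B" using ec e by (auto simp: edge_boundary_def)
    qed
    have "?B \<subseteq> Pow V" using cV by auto
    then show "finite ?B" using assms(2) by (meson finite_Pow_iff finite_subset)
  qed
  finally show ?thesis .
qed

lemma card_edge_boundary_ge:
  assumes "cubical_complex V C" "neighbourly V C" "finite V" "X \<subseteq> V"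
  shows "2 * (card X * card (V - X)) \<le> card (edge_boundary (complex_edges V C) X) * card V"
proof -
  let ?B = "edge_boundary (complex_edges V C) X" and ?Z = "X \<times> (V - X)"
  let ?span = "\<lambda>z. spanned C (fst z) (snd z)"
  have "C \<subseteq> Pow V" using assms(1) unfolding cubical_complex_def by auto
  then have finC: "finite C" using assms(3) by (meson finite_Pow_iff finite_subset)
  have "?B \<subseteq> Pow V" by (auto simp: edge_boundary_def complex_edges_def)
  then have finB: "finite ?B" using assms(3) by (meson finite_Pow_iff finite_subset)
  have finZ: "finite ?Z" using assms finite_subset by auto
  have "card X * card (V - X) = (\<Sum>z\<in>?Z. 1)" by (simp add: card_cartesian_product)
  \<comment> \<open>Pairs are grouped by the cube they span; by \<open>spanned_mem\<close> every
    pair falls into some group.\<close>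
  also have "\<dots> = (\<Sum>c\<in>C. \<Sum>z\<in>{z \<in> ?Z. ?span z = c}. 1)"
    using finZ finC by (rule sum.group[symmetric]) (use assms spanned_mem in fastforce)
  also have "\<dots> = (\<Sum>c\<in>C. card {z \<in> ?Z. ?span z = c})" by simp
  also have "\<dots> \<le> (\<Sum>c\<in>C. card {e \<in> ?B. e \<subseteq> c})"
    by (intro sum_mono card_pairs_spanning_cube_le assms)
  \<comment> \<open>The incidences of boundary edges and cubes are now counted from the side of the
    edges.\<close>
  also have "\<dots> = (\<Sum>e\<in>?B. card {c \<in> C. e \<subseteq> c})"
    by (rule sum_multicount_gen[OF finC finB]) simp
  finally have "2 * (card X * card (V - X)) \<le> (\<Sum>e\<in>?B. 2 * card {c \<in> C. e \<subseteq> c})"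
    by (simp add: sum_distrib_left[symmetric])
  also have "\<dots> \<le> (\<Sum>e\<in>?B. card V)"
  proof (rule sum_mono)
    fix e assume "e \<in> ?B"
    then obtain u v where "e = {u, v}" "u \<noteq> v"
      by (auto simp: edge_boundary_def complex_edges_def)
    then show "2 * card {c \<in> C. e \<subseteq> c} \<le> card V"
      using card_cubes_containing_edge_le[OF assms(1,3)] by auto
  qed
  finally show ?thesis by simp
qed

theorem theorem1:
  fixes V :: "'a set" and C :: "'a set set"
  assumes "cubical_complex V C"
    and "neighbourly V C"
    and "finite V"
  shows "edge_expansion V (complex_edges V C) \<ge> 1"
  unfolding edge_expansion_def
proof (rule INF_greatest)
  let ?b = "\<lambda>X. card (edge_boundary (complex_edges V C) X)"
  fix X assume "X \<in> {X. X \<subseteq> V \<and> 0 < card X \<and> real (card X) \<le> real (card V) / 2}"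
  then have X: "X \<subseteq> V" "0 < card X" "2 * card X \<le> card V" by auto
  \<comment> \<open>As \<open>X\<close> has at most half of the vertices, its complement has at
    least half.\<close>
  have "card V \<le> 2 * card (V - X)"
    using X assms(3) by (simp add: card_Diff_subset finite_subset)
  then have "card X * card V \<le> 2 * (card X * card (V - X))"
    using mult_le_mono2[of "card V" "2 * card (V - X)" "card X"] by (simp add: ac_simps)
  also have "\<dots> \<le> ?b X * card V" by (rule card_edge_boundary_ge[OF assms X(1)])
  \<comment> \<open>The factor \<open>card V\<close> cancels, being positive because
    \<open>0 < card X\<close> and \<open>2 * card X \<le> card V\<close>.\<close>
  finally have "card X \<le> ?b X" using X by auto
  then have "1 \<le> real (?b X) / real (card X)" using X by (simp add: field_simps)
  then show "1 \<le> ereal (real (?b X) / real (card X))" by simp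
qed

end
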